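(* Let $G$ be a non-empty finite simple graph without isolated vertices. If $G$ is a star forest or $G=P_4$, then $\chi^+(G)=2$. If $G=K_3$, then $\chi^+(G)=3$. For all other such $G$, $\chi^+(G)=\infty$.
   Context: An edge-ordering (labeling) $L$ of a simple graph $G$ is a linear order on its edges, giving the edge-ordered graph $G^L$; isomorphisms of edge-ordered graphs preserve order, subgraphs carry the induced order. A simple graph can avoid an edge-ordered graph $H$ if some edge-ordering of it has no subgraph isomorphic to $H$. The order chromatic number $\chi'_<(H)$ is the least chromatic number of a finite simple graph that cannot avoid $H$ ($\infty$ if none). $\chi^+(G)=\max_L \chi'_<(G^L)$ over all edge-orderings $L$ of $G$. A star forest is a non-empty graph all of whose components are stars; $P_4$ is the path on four vertices. *)

theory Defs
  imports "HOL-Library.Extended_Nat"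
begin

record 'a sgraph =
  verts :: "'a set"
  edges :: "'a set set"

definition simple_graph :: "'a sgraph \<Rightarrow> bool" where
  "simple_graph G \<longleftrightarrow> (\<forall>e\<in>edges G. e \<subseteq> verts G \<and> card e = 2)"

definition finite_simple_graph :: "'a sgraph \<Rightarrow> bool" where
  "finite_simple_graph G \<longleftrightarrow> simple_graph G \<and> finite (verts G)"

definition isolated_vertex :: "'a sgraph \<Rightarrow> 'a \<Rightarrow> bool" where
  "isolated_vertex G v \<longleftrightarrow> v \<in> verts G \<and> (\<forall>e\<in>edges G. v \<notin> e)"

definition subgraph :: "'a sgraph \<Rightarrow> 'a sgraph \<Rightarrow> bool" where
  "subgraph K G \<longleftrightarrow> simple_graph K \<and> verts K \<subseteq> verts G \<and> edges K \<subseteq> edges G"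

definition induced_subgraph :: "'a sgraph \<Rightarrow> 'a set \<Rightarrow> 'a sgraph" where
  "induced_subgraph G W = \<lparr>verts = verts G \<inter> W, edges = {e \<in> edges G. e \<subseteq> W}\<rparr>"

definition graph_isomorphism :: "('a \<Rightarrow> 'b) \<Rightarrow> 'a sgraph \<Rightarrow> 'b sgraph \<Rightarrow> bool" where
  "graph_isomorphism f G H \<longleftrightarrow>
     bij_betw f (verts G) (verts H) \<and>
     (\<forall>u\<in>verts G. \<forall>v\<in>verts G. {u, v} \<in> edges G \<longleftrightarrow> {f u, f v} \<in> edges H)"

definition graph_isomorphic :: "'a sgraph \<Rightarrow> 'b sgraph \<Rightarrow> bool" where
  "graph_isomorphic G H \<longleftrightarrow> (\<exists>f. graph_isomorphism f G H)"

definition complete_graph :: "nat \<Rightarrow> nat sgraph" where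
  "complete_graph n = \<lparr>verts = {..<n}, edges = {e. e \<subseteq> {..<n} \<and> card e = 2}\<rparr>"

text \<open>The path on \<open>n\<close> vertices (not \<open>n\<close> edges).\<close>

definition path_graph :: "nat \<Rightarrow> nat sgraph" where
  "path_graph n = \<lparr>verts = {..<n}, edges = {{i, Suc i} | i. Suc i < n}\<rparr>"

text \<open>The star with centre \<open>0\<close> and \<open>m\<close> leaves.\<close>

definition star_graph :: "nat \<Rightarrow> nat sgraph" where
  "star_graph m = \<lparr>verts = {..m}, edges = {{0, i} | i. 1 \<le> i \<and> i \<le> m}\<rparr>"

definition adjacency :: "'a sgraph \<Rightarrow> 'a rel" where
  "adjacency G = {(u, v). {u, v} \<in> edges G}"

definition components :: "'a sgraph \<Rightarrow> 'a sgraph set" where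
  "components G = {induced_subgraph G ((adjacency G)\<^sup>* `` {v}) | v. v \<in> verts G}"

definition star_forest :: "'a sgraph \<Rightarrow> bool" where
  "star_forest G \<longleftrightarrow>
     edges G \<noteq> {} \<and> (\<forall>C\<in>components G. \<exists>m\<ge>1. graph_isomorphic C (star_graph m))"

definition proper_colouring :: "'a sgraph \<Rightarrow> nat \<Rightarrow> ('a \<Rightarrow> nat) \<Rightarrow> bool" where
  "proper_colouring G k c \<longleftrightarrow>
     (\<forall>v\<in>verts G. c v < k) \<and> (\<forall>u v. {u, v} \<in> edges G \<longrightarrow> c u \<noteq> c v)"

definition chromatic_number :: "'a sgraph \<Rightarrow> nat" where
  "chromatic_number G = (LEAST k. \<exists>c. proper_colouring G k c)"

text \<open>An edge-ordered graph is passed as a graph together with a reflexive linear order,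
  given as a relation, on its edge set.\<close>

definition edge_ordering :: "'a sgraph \<Rightarrow> 'a set rel \<Rightarrow> bool" where
  "edge_ordering G L \<longleftrightarrow> linear_order_on (edges G) L"

definition eo_isomorphic :: "'a sgraph \<Rightarrow> 'a set rel \<Rightarrow> 'b sgraph \<Rightarrow> 'b set rel \<Rightarrow> bool" where
  "eo_isomorphic G L H M \<longleftrightarrow>
     (\<exists>f. graph_isomorphism f G H \<and>
          (\<forall>d\<in>edges G. \<forall>e\<in>edges G. (d, e) \<in> L \<longleftrightarrow> (f ` d, f ` e) \<in> M))"

definition eo_contains :: "'a sgraph \<Rightarrow> 'a set rel \<Rightarrow> 'b sgraph \<Rightarrow> 'b set rel \<Rightarrow> bool" where
  "eo_contains G L H M \<longleftrightarrow>
     (\<exists>K. subgraph K G \<and> eo_isomorphic K (Restr L (edges K)) H M)"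

definition can_avoid :: "'a sgraph \<Rightarrow> 'b sgraph \<Rightarrow> 'b set rel \<Rightarrow> bool" where
  "can_avoid G H M \<longleftrightarrow> (\<exists>L. edge_ordering G L \<and> \<not> eo_contains G L H M)"

text \<open>Every finite simple graph is isomorphic to one whose vertices are natural numbers, so
  ranging over \<^typ>\<open>nat sgraph\<close> covers all finite simple graphs. The infimum in
  \<^typ>\<open>enat\<close> is attained if the set is non-empty, and is \<open>\<infinity>\<close> otherwise.\<close>

definition order_chromatic_number :: "'a sgraph \<Rightarrow> 'a set rel \<Rightarrow> enat" where
  "order_chromatic_number H M =
     Inf {enat (chromatic_number K) | K :: nat sgraph.
            finite_simple_graph K \<and> \<not> can_avoid K H M}"

definition chi_plus :: "'a sgraph \<Rightarrow> enat" where
  "chi_plus G = Max {order_chromatic_number G L | L. edge_ordering G L}"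

end

theory Submission
  imports Defs "HOL-Library.Ramsey"
begin

text \<open>If \<open>G\<close> is not a star forest, some edge \<open>uv\<close> has both endpoints of degree at least two, say with
  further edges \<open>f\<close> at \<open>u\<close> and \<open>f'\<close> at \<open>v\<close>; unless \<open>G\<close> is \<open>P\<^sub>4\<close> or \<open>K\<^sub>3\<close> there is a fourth edge \<open>h\<close>, which by
  symmetry misses \<open>u\<close>. In an ordering that starts with \<open>uv < h < f < f'\<close> the edges at no vertex form
  an initial segment. But if the edges of a host graph are sorted by their smaller endpoint, then in
  every subgraph the edges at the smallest vertex do form an initial segment, so every host avoids
  this ordering of \<open>G\<close>.

  Conversely, by Ramsey's theorem every ordering of a large \<open>K\<^sub>N\<^sub>,\<^sub>N\<close> contains a large complete
  bipartite subgraph whose edges are sorted by their endpoint in one fixed side. Every ordered star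
  forest embeds there, with its leaves on that side in the order of their edges, and so does every
  ordering of \<open>P\<^sub>4\<close>. For \<open>K\<^sub>3\<close> all orderings are isomorphic.\<close>

section \<open>Isomorphisms and embeddings\<close>

lemma simple_graph_edge_subset: "simple_graph G \<Longrightarrow> e \<in> edges G \<Longrightarrow> e \<subseteq> verts G"
  by (auto simp: simple_graph_def)

lemma simple_graph_edgeE:
  assumes "simple_graph G" "e \<in> edges G"
  obtains u v where "e = {u, v}" "u \<noteq> v" "u \<in> verts G" "v \<in> verts G"
  using assms by (auto simp: simple_graph_def card_2_iff)

text \<open>In terms of images of the vertex and edge sets, isomorphisms are easy to build and to
  invert. For the converse, injectivity on vertices makes \<open>f\<close> injective on edges, so an
  edge of \<open>H\<close> between \<open>f u\<close> and \<open>f v\<close> can only come from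
  \<open>{u, v}\<close>.\<close>

lemma graph_isomorphism_iff_image:
  assumes "simple_graph G" "simple_graph H"
  shows "graph_isomorphism f G H \<longleftrightarrow>
    inj_on f (verts G) \<and> f ` verts G = verts H \<and> (`) f ` edges G = edges H"
proof (intro iffI conjI; (elim conjE)?)
  assume iso: "graph_isomorphism f G H"
  then have bij: "bij_betw f (verts G) (verts H)"
    and adj: "\<And>u v. u \<in> verts G \<Longrightarrow> v \<in> verts G \<Longrightarrow> {u, v} \<in> edges G \<longleftrightarrow> {f u, f v} \<in> edges H"
    by (auto simp: graph_isomorphism_def)
  show "inj_on f (verts G)" "f ` verts G = verts H"
    using bij by (auto simp: bij_betw_def)
  show "(`) f ` edges G = edges H"
  proof (intro equalityI subsetI)
    fix e assume "e \<in> (`) f ` edges G"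
    then show "e \<in> edges H"
      using adj assms(1) by (auto elim!: simple_graph_edgeE)
  next
    fix e assume e: "e \<in> edges H"
    then obtain x y where "e = {x, y}" "x \<in> verts H" "y \<in> verts H"
      using assms(2) by (auto elim: simple_graph_edgeE)
    moreover from this obtain u v where "u \<in> verts G" "v \<in> verts G" "x = f u" "y = f v"
      using bij unfolding bij_betw_def by (metis imageE)
    ultimately show "e \<in> (`) f ` edges G"
      using adj e by (intro image_eqI[of _ _ "{u, v}"]) auto
  qed
next
  assume inj: "inj_on f (verts G)" and V: "f ` verts G = verts H" and E: "(`) f ` edges G = edges H"
  have "{u, v} \<in> edges G" if uv: "u \<in> verts G" "v \<in> verts G" "{f u, f v} \<in> edges H" for u v
  proof -
    have "f ` {u, v} \<in> (`) f ` edges G"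
      using uv(3) E by simp
    then obtain e where e: "e \<in> edges G" "f ` e = f ` {u, v}"
      by (metis imageE)
    then have "e = {u, v}"
      using inj_on_image_eq_iff[OF inj simple_graph_edge_subset[OF assms(1) e(1)], of "{u, v}"] e uv by simp
    with e show ?thesis by simp
  qed
  moreover have "{f u, f v} \<in> edges H" if "{u, v} \<in> edges G" for u v
    using imageI[OF that, of "(`) f"] E by simp
  ultimately show "graph_isomorphism f G H"
    using inj V by (auto simp: graph_isomorphism_def bij_betw_def)
qed

lemma image_image_the_inv_into:
  assumes "inj_on f A" "\<And>e. e \<in> E \<Longrightarrow> e \<subseteq> A"
  shows "(`) (the_inv_into A f) ` (`) f ` E = E"
proof -
  have "the_inv_into A f ` f ` e = e" if "e \<in> E" for e
    using assms(1) assms(2)[OF that] by (force simp: image_image the_inv_into_f_f subset_iff)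
  then show ?thesis by (force simp: image_image)
qed

lemma graph_isomorphism_the_inv_into:
  assumes "simple_graph G" "simple_graph H" "graph_isomorphism f G H"
  shows "graph_isomorphism (the_inv_into (verts G) f) H G"
proof -
  have inj: "inj_on f (verts G)" and V: "f ` verts G = verts H" and E: "(`) f ` edges G = edges H"
    using assms graph_isomorphism_iff_image by blast+
  show ?thesis
    unfolding graph_isomorphism_iff_image[OF assms(2,1)]
    using image_image_the_inv_into[OF inj, of "edges G"] simple_graph_edge_subset[OF assms(1)]
      inj_on_the_inv_into[OF inj] the_inv_into_onto[OF inj]
    unfolding V E by blast
qed

section \<open>Edge-orderings and ordered copies as embeddings\<close>

lemma edge_orderingD:
  assumes "edge_ordering G L"
  shows "L \<subseteq> edges G \<times> edges G" "trans L" "antisym L"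
    "\<And>d e. d \<in> edges G \<Longrightarrow> e \<in> edges G \<Longrightarrow> (d, e) \<in> L \<or> (e, d) \<in> L"
  using assms unfolding edge_ordering_def order_on_defs refl_on_def total_on_def by metis+

text \<open>Inverting the isomorphism from the subgraph gives the embedding. Conversely, preserving
  \<open>M\<close> in one direction is enough: \<open>M\<close> is total, \<open>L\<close> is
  antisymmetric and \<open>\<phi>\<close> is injective on edges, so the order is reflected as
  well.\<close>

lemma eo_contains_iff_embedding:
  assumes G: "simple_graph G" and H: "simple_graph H"
    and L: "edge_ordering G L" and M: "edge_ordering H M"
  shows "eo_contains G L H M \<longleftrightarrow>
    (\<exists>\<phi>. inj_on \<phi> (verts H) \<and> \<phi> ` verts H \<subseteq> verts G \<and> (\<forall>e\<in>edges H. \<phi> ` e \<in> edges G) \<and>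
         (\<forall>d e. (d, e) \<in> M \<longrightarrow> (\<phi> ` d, \<phi> ` e) \<in> L))" (is "_ \<longleftrightarrow> ?R")
proof
  assume "eo_contains G L H M"
  then obtain K f where K: "subgraph K G" and f: "graph_isomorphism f K H"
    and ord: "\<And>d e. d \<in> edges K \<Longrightarrow> e \<in> edges K \<Longrightarrow> (d, e) \<in> Restr L (edges K) \<longleftrightarrow> (f ` d, f ` e) \<in> M"
    unfolding eo_contains_def eo_isomorphic_def by blast
  have sK: "simple_graph K" and sub: "verts K \<subseteq> verts G" "edges K \<subseteq> edges G"
    using K by (auto simp: subgraph_def)
  define \<phi> where "\<phi> = the_inv_into (verts K) f"
  have \<phi>: "graph_isomorphism \<phi> H K"
    using graph_isomorphism_the_inv_into[OF sK H f] by (simp add: \<phi>_def)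
  have f_inj: "inj_on f (verts K)" and f_V: "f ` verts K = verts H"
    using f graph_isomorphism_iff_image[OF sK H] by auto
  have inj: "inj_on \<phi> (verts H)" and V: "\<phi> ` verts H = verts K" and E: "(`) \<phi> ` edges H = edges K"
    using \<phi> graph_isomorphism_iff_image[OF H sK] by auto
  have f_\<phi>: "f ` \<phi> ` e = e" if "e \<in> edges H" for e
  proof -
    have "\<forall>x\<in>e. f (\<phi> x) = x"
      using simple_graph_edge_subset[OF H that] f_V f_the_inv_into_f[OF f_inj]
      by (auto simp: \<phi>_def)
    then show ?thesis by (force simp: image_image)
  qed
  have "(\<phi> ` d, \<phi> ` e) \<in> L" if "(d, e) \<in> M" for d e
  proof -
    have de: "d \<in> edges H" "e \<in> edges H" using that edge_orderingD(1)[OF M] by auto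
    then have "\<phi> ` d \<in> edges K" "\<phi> ` e \<in> edges K" using E by auto
    with ord[OF this] f_\<phi> de that show ?thesis by simp
  qed
  moreover have "\<phi> ` e \<in> edges G" if "e \<in> edges H" for e
    using E sub(2) that by auto
  ultimately show ?R
    using inj V sub(1) by (intro exI[of _ \<phi>]) simp
next
  assume ?R
  then obtain \<phi> where inj: "inj_on \<phi> (verts H)" and V: "\<phi> ` verts H \<subseteq> verts G"
    and E: "\<And>e. e \<in> edges H \<Longrightarrow> \<phi> ` e \<in> edges G"
    and ord: "\<And>d e. (d, e) \<in> M \<Longrightarrow> (\<phi> ` d, \<phi> ` e) \<in> L" by blast
  define K where "K = \<lparr>verts = \<phi> ` verts H, edges = (`) \<phi> ` edges H\<rparr>"
  have sK: "simple_graph K"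
    using H inj unfolding simple_graph_def K_def
    by (auto simp: card_image inj_on_subset)
  have "subgraph K G"
    using sK V E by (auto simp: subgraph_def K_def)
  moreover have "graph_isomorphism \<phi> H K"
    unfolding graph_isomorphism_iff_image[OF H sK] using inj by (simp add: K_def)
  from graph_isomorphism_the_inv_into[OF H sK this]
  have iso: "graph_isomorphism (the_inv_into (verts H) \<phi>) K H" .
  have cancel: "the_inv_into (verts H) \<phi> ` \<phi> ` e = e" if "e \<in> edges H" for e
    using inj simple_graph_edge_subset[OF H that]
    by (force simp: image_image the_inv_into_f_f subset_iff)
  have "(\<phi> ` d, \<phi> ` e) \<in> L \<longleftrightarrow> (d, e) \<in> M" if de: "d \<in> edges H" "e \<in> edges H" for d e
  proof
    assume *: "(\<phi> ` d, \<phi> ` e) \<in> L"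
    show "(d, e) \<in> M"
    proof (rule ccontr)
      assume "(d, e) \<notin> M"
      then have ed: "(e, d) \<in> M" using edge_orderingD(4)[OF M de] by blast
      then have eq: "\<phi> ` d = \<phi> ` e"
        using antisymD[OF edge_orderingD(3)[OF L] *] ord by blast
      have "d = e" using cancel[OF de(1)] cancel[OF de(2)] unfolding eq by (rule subst)
      with ed \<open>(d, e) \<notin> M\<close> show False by simp
    qed
  qed (rule ord)
  then have "\<forall>d\<in>edges K. \<forall>e\<in>edges K. (d, e) \<in> Restr L (edges K) \<longleftrightarrow>
      (the_inv_into (verts H) \<phi> ` d, the_inv_into (verts H) \<phi> ` e) \<in> M"
    using cancel by (simp add: K_def)
  with iso have "eo_isomorphic K (Restr L (edges K)) H M"
    unfolding eo_isomorphic_def by blast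
  ultimately show "eo_contains G L H M"
    unfolding eo_contains_def by blast
qed

text \<open>Every concrete ordering constructed below is the order of the naturals pulled back along
  an injective key.\<close>

lemma edge_ordering_key:
  fixes k :: "'a set \<Rightarrow> nat"
  assumes "inj_on k (edges G)"
  shows "edge_ordering G {(d, e). d \<in> edges G \<and> e \<in> edges G \<and> k d \<le> k e}"
  unfolding edge_ordering_def order_on_defs
proof (intro conjI)
  show "antisym {(d, e). d \<in> edges G \<and> e \<in> edges G \<and> k d \<le> k e}"
    using assms by (auto intro!: antisymI dest: inj_onD)
qed (auto simp: refl_on_def total_on_def trans_def)

lemma finite_edges: "finite_simple_graph G \<Longrightarrow> finite (edges G)"
  by (rule finite_subset[of _ "Pow (verts G)"]) (auto simp: finite_simple_graph_def simple_graph_def)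

section \<open>Chromatic numbers\<close>

lemma chromatic_number_le: "proper_colouring G k c \<Longrightarrow> chromatic_number G \<le> k"
  unfolding chromatic_number_def by (auto intro: Least_le)

text \<open>The \<open>LEAST\<close> is attained because some proper colouring exists: an injective
  numbering of the finite vertex set is one.\<close>

lemma proper_colouring_chromatic_number:
  assumes "finite_simple_graph G"
  obtains c where "proper_colouring G (chromatic_number G) c"
proof -
  have "finite (verts G)" and G: "simple_graph G"
    using assms by (auto simp: finite_simple_graph_def)
  then obtain c :: "'a \<Rightarrow> nat" and n where c: "c ` verts G = {i. i < n}" "inj_on c (verts G)"
    using finite_imp_inj_to_nat_seg by metis
  have "c u \<noteq> c v" if "{u, v} \<in> edges G" for u v
  proof -
    have "u \<noteq> v" "u \<in> verts G" "v \<in> verts G"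
      using G that by (auto simp: simple_graph_def card_2_iff)
    with c(2) show ?thesis by (auto simp: inj_on_def)
  qed
  then have "proper_colouring G n c"
    using c(1) by (auto simp: proper_colouring_def)
  then have "\<exists>c. proper_colouring G (chromatic_number G) c"
    unfolding chromatic_number_def by (intro LeastI) blast
  with that show ?thesis by blast
qed

lemma two_le_chromatic_number:
  assumes "finite_simple_graph G" "edges G \<noteq> {}"
  shows "2 \<le> chromatic_number G"
proof -
  obtain c where c: "proper_colouring G (chromatic_number G) c"
    using proper_colouring_chromatic_number[OF assms(1)] .
  obtain u v where "{u, v} \<in> edges G" "u \<in> verts G" "v \<in> verts G"
    using assms by (metis all_not_in_conv finite_simple_graph_def simple_graph_edgeE)
  with c have "c u \<noteq> c v" "c u < chromatic_number G" "c v < chromatic_number G"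
    by (auto simp: proper_colouring_def)
  then show ?thesis by linarith
qed

lemma three_le_chromatic_number:
  assumes "finite_simple_graph G" "{x, y} \<in> edges G" "{x, z} \<in> edges G" "{y, z} \<in> edges G"
  shows "3 \<le> chromatic_number G"
proof -
  obtain c where c: "proper_colouring G (chromatic_number G) c"
    using proper_colouring_chromatic_number[OF assms(1)] .
  have "x \<in> verts G" "y \<in> verts G" "z \<in> verts G"
    using assms by (auto simp: finite_simple_graph_def simple_graph_def)
  with c have "c x < chromatic_number G" "c y < chromatic_number G" "c z < chromatic_number G"
    by (auto simp: proper_colouring_def)
  moreover have "c x \<noteq> c y" "c x \<noteq> c z" "c y \<noteq> c z"
    using c assms by (auto simp: proper_colouring_def)
  ultimately show ?thesis by linarith
qed

text \<open>Needed to reason about \<open>Max\<close> in \<open>chi_plus\<close>. Orderings are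
  subsets of the finite set \<open>edges G \<times> edges G\<close>.\<close>

lemma finite_order_chromatic_numbers:
  assumes "finite_simple_graph G"
  shows "finite {order_chromatic_number G L | L. edge_ordering G L}"
proof -
  have "{L. edge_ordering G L} \<subseteq> Pow (edges G \<times> edges G)"
    using edge_orderingD(1) by blast
  then have "finite {L. edge_ordering G L}"
    using finite_edges[OF assms] by (meson finite_Pow_iff finite_SigmaI finite_subset)
  then show ?thesis by simp
qed

lemma ex_edge_ordering:
  assumes "finite_simple_graph G"
  obtains L where "edge_ordering G L"
proof -
  obtain k :: "'a set \<Rightarrow> nat" where "inj_on k (edges G)"
    using finite_imp_inj_to_nat_seg[OF finite_edges[OF assms]] by metis
  from edge_ordering_key[OF this] that show ?thesis by blast
qed

lemma chi_plus_eqI: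
  assumes "finite_simple_graph G" "\<And>L. edge_ordering G L \<Longrightarrow> order_chromatic_number G L = c"
  shows "chi_plus G = c"
proof -
  have "{order_chromatic_number G L | L. edge_ordering G L} = {c}"
    using assms ex_edge_ordering[OF assms(1)] by (auto, metis)
  then show ?thesis by (simp add: chi_plus_def)
qed

lemma chi_plus_eq_infinity:
  assumes "finite_simple_graph G" "edge_ordering G L" "order_chromatic_number G L = \<infinity>"
  shows "chi_plus G = \<infinity>"
proof -
  have "\<infinity> \<in> {order_chromatic_number G L | L. edge_ordering G L}"
    using assms(2) unfolding assms(3)[symmetric] by blast
  then have "\<infinity> \<le> chi_plus G"
    unfolding chi_plus_def by (rule Max_ge[OF finite_order_chromatic_numbers[OF assms(1)]])
  then show ?thesis by simp
qed

lemma order_chromatic_number_eqI: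
  fixes K :: "nat sgraph"
  assumes "finite_simple_graph K" "\<not> can_avoid K H M" "chromatic_number K \<le> n"
    and "\<And>K :: nat sgraph. finite_simple_graph K \<Longrightarrow> \<not> can_avoid K H M \<Longrightarrow> n \<le> chromatic_number K"
  shows "order_chromatic_number H M = enat n"
proof (rule antisym)
  have "order_chromatic_number H M \<le> enat (chromatic_number K)"
    unfolding order_chromatic_number_def using assms by (intro Inf_lower) blast
  also have "\<dots> \<le> enat n" using assms by simp
  finally show "order_chromatic_number H M \<le> enat n" .
  show "enat n \<le> order_chromatic_number H M"
    unfolding order_chromatic_number_def using assms(4) by (intro Inf_greatest) auto
qed

text \<open>Source of the lower bounds: a host that cannot avoid an ordering of \<open>H\<close>
  contains \<open>H\<close> as a plain graph, so it has at least the chromatic number forced by an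
  edge or a triangle of \<open>H\<close>.\<close>

lemma embedding_if_not_can_avoid:
  assumes "finite_simple_graph K" "simple_graph H" "edge_ordering H M" "\<not> can_avoid K H M"
  obtains \<phi> where "inj_on \<phi> (verts H)" "\<And>e. e \<in> edges H \<Longrightarrow> \<phi> ` e \<in> edges K"
proof -
  obtain L where L: "edge_ordering K L" using ex_edge_ordering[OF assms(1)] .
  then have "eo_contains K L H M"
    using assms by (auto simp: can_avoid_def)
  then show ?thesis
    using eo_contains_iff_embedding[OF _ assms(2) L assms(3)] assms(1) that
    by (auto simp: finite_simple_graph_def)
qed

section \<open>Graphs with infinite order chromatic number\<close>

text \<open>The host is sorted by smaller endpoint. In a copy of \<open>G\<close>, the vertex with
  the smallest image has all its edges before all others, whereas \<open>no_star\<close> gives at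
  each vertex an edge preceded by one that misses the vertex.\<close>

lemma can_avoid_if_no_initial_star:
  fixes K :: "nat sgraph"
  assumes K: "finite_simple_graph K" and G: "finite_simple_graph G" "verts G \<noteq> {}"
    and M: "edge_ordering G M"
    and no_star: "\<And>x. x \<in> verts G \<Longrightarrow> \<exists>(d, e)\<in>M. x \<notin> d \<and> x \<in> e"
  shows "can_avoid K G M"
proof -
  have sK: "simple_graph K" and sG: "simple_graph G" and finG: "finite (verts G)"
    using K G by (auto simp: finite_simple_graph_def)
  obtain g and n :: nat where g: "g ` edges K = {i. i < n}" "inj_on g (edges K)"
    using finite_imp_inj_to_nat_seg[OF finite_edges[OF K]] by metis
  \<comment> \<open>Lexicographic key: since \<open>g e < n\<close> on edges, each value of
    \<open>Min e\<close> owns a block of length \<open>n\<close>, and \<open>g\<close> breaks ties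
    inside the block.\<close>
  define k where "k e = Min e * n + g e" for e :: "nat set"
  have g_less: "g e < n" if "e \<in> edges K" for e
    using g(1) that by auto
  have k_mono: "k d < k e" if "d \<in> edges K" "Min d < Min e" for d e
  proof -
    have "k d < Suc (Min d) * n" using g_less[OF that(1)] by (simp add: k_def)
    also have "\<dots> \<le> Min e * n" using that(2) by (intro mult_right_mono) auto
    also have "\<dots> \<le> k e" by (simp add: k_def)
    finally show ?thesis .
  qed
  have "inj_on k (edges K)"
  proof (rule inj_onI)
    fix d e assume de: "d \<in> edges K" "e \<in> edges K" "k d = k e"
    then have "Min d = Min e"
      using k_mono[of d e] k_mono[of e d] by (metis less_irrefl linorder_neqE_nat)
    with de have "g d = g e" by (simp add: k_def)
    with g(2) de show "d = e" by (auto dest: inj_onD)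
  qed
  define L where "L = {(d, e). d \<in> edges K \<and> e \<in> edges K \<and> k d \<le> k e}"
  have L: "edge_ordering K L"
    unfolding L_def using \<open>inj_on k (edges K)\<close> by (rule edge_ordering_key)
  have "\<not> eo_contains K L G M"
  proof
    assume "eo_contains K L G M"
    then obtain \<phi> where inj: "inj_on \<phi> (verts G)"
      and ord: "\<And>d e. (d, e) \<in> M \<Longrightarrow> (\<phi> ` d, \<phi> ` e) \<in> L"
      using eo_contains_iff_embedding[OF sK sG L M] by blast
    \<comment> \<open>The vertex placed lowest in the host is the one at which
      \<open>no_star\<close> is contradicted.\<close>
    obtain x where x: "x \<in> verts G" "\<And>y. y \<in> verts G \<Longrightarrow> \<phi> x \<le> \<phi> y"
      using finG G(2)
      by (metis (no_types, lifting) arg_min_if_finite(1) arg_min_least)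
    obtain d e where de: "(d, e) \<in> M" "x \<notin> d" "x \<in> e"
      using no_star[OF x(1)] by blast
    then have dG: "d \<in> edges G" and eG: "e \<in> edges G"
      using edge_orderingD(1)[OF M] by auto
    have sub: "d \<subseteq> verts G" "e \<subseteq> verts G" and "d \<noteq> {}"
      using sG dG eG by (auto simp: simple_graph_def)
    have fin: "finite d" "finite e" using sub finG finite_subset by auto
    have "\<phi> x < \<phi> y" if "y \<in> d" for y
      using x(2)[of y] inj sub(1) x(1) de(2) that by (metis inj_onD le_neq_implies_less subsetD)
    then have "\<phi> x < Min (\<phi> ` d)" using fin \<open>d \<noteq> {}\<close> by simp
    moreover have "Min (\<phi> ` e) \<le> \<phi> x" using fin de(3) by simp
    moreover have "\<phi> ` e \<in> edges K" "k (\<phi> ` d) \<le> k (\<phi> ` e)"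
      using ord[OF de(1)] by (auto simp: L_def)
    ultimately show False using k_mono[of "\<phi> ` e" "\<phi> ` d"] by linarith
  qed
  with L show ?thesis by (auto simp: can_avoid_def)
qed

lemma order_chromatic_number_eq_infinity:
  assumes "\<And>K :: nat sgraph. finite_simple_graph K \<Longrightarrow> can_avoid K H M"
  shows "order_chromatic_number H M = \<infinity>"
proof -
  have "{enat (chromatic_number K) | K :: nat sgraph. finite_simple_graph K \<and> \<not> can_avoid K H M} = {}"
    using assms by blast
  then show ?thesis unfolding order_chromatic_number_def by (metis Inf_empty top_enat_def)
qed

text \<open>In the order \<open>{u, v}\<close>, \<open>h\<close>, \<open>f\<close>,
  \<open>f'\<close> no vertex has an initial star: at \<open>u\<close> the edge \<open>h\<close>
  precedes \<open>f\<close>, at \<open>v\<close> the edge \<open>f\<close> precedes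
  \<open>f'\<close>, and any other vertex is missed by the very first edge.\<close>

lemma chi_plus_eq_infinity_if_four_edges:
  assumes G: "finite_simple_graph G" "\<not> (\<exists>v. isolated_vertex G v)"
    and E: "{u, v} \<in> edges G" "f \<in> edges G" "f' \<in> edges G" "h \<in> edges G"
    and f: "u \<in> f" "v \<notin> f" and f': "v \<in> f'" "u \<notin> f'" and h: "h \<noteq> f" "h \<noteq> f'" "u \<notin> h"
  shows "chi_plus G = \<infinity>"
proof -
  obtain g :: "'a set \<Rightarrow> nat" where g: "inj_on g (edges G)"
    using finite_imp_inj_to_nat_seg[OF finite_edges[OF G(1)]] by metis
  \<comment> \<open>The shift by 4 puts all remaining edges, in arbitrary order, behind the four
    chosen ones.\<close>
  define k where "k e = (if e = {u, v} then 0 else if e = h then 1 else if e = f then 2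
    else if e = f' then 3 else g e + 4)" for e
  have neq: "h \<noteq> {u, v}" "f \<noteq> {u, v}" "f' \<noteq> {u, v}" "f \<noteq> f'"
    using f f' h by auto
  have "inj_on k (edges G)"
    using g by (auto simp: k_def inj_on_def)
  define M where "M = {(d, e). d \<in> edges G \<and> e \<in> edges G \<and> k d \<le> k e}"
  have M: "edge_ordering G M"
    unfolding M_def using \<open>inj_on k (edges G)\<close> by (rule edge_ordering_key)
  have ord: "(h, f) \<in> M" "(f, f') \<in> M" "\<And>e. e \<in> edges G \<Longrightarrow> ({u, v}, e) \<in> M"
    using E neq h by (auto simp: M_def k_def)
  have "\<exists>(d, e)\<in>M. x \<notin> d \<and> x \<in> e" if "x \<in> verts G" for x
  proof -
    consider "x = u" | "x = v" | "x \<notin> {u, v}" by blast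
    then show ?thesis
    proof cases
      case 1
      with ord(1) f h show ?thesis by (intro bexI[of _ "(h, f)"]) auto
    next
      case 2
      with ord(2) f f' show ?thesis by (intro bexI[of _ "(f, f')"]) auto
    next
      case 3
      obtain e where "e \<in> edges G" "x \<in> e"
        using G(2) \<open>x \<in> verts G\<close> by (auto simp: isolated_vertex_def)
      with 3 ord(3) show ?thesis by (intro bexI[of _ "({u, v}, e)"]) auto
    qed
  qed
  moreover have "verts G \<noteq> {}"
    using G(1) E(1) by (auto simp: finite_simple_graph_def simple_graph_def)
  ultimately have "order_chromatic_number G M = \<infinity>"
    using can_avoid_if_no_initial_star[OF _ G(1) _ M]
    by (intro order_chromatic_number_eq_infinity) blast
  with G(1) M show ?thesis by (rule chi_plus_eq_infinity)
qed

section \<open>Star forests\<close>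

lemma simple_star_graph: "simple_graph (star_graph m)"
  by (auto simp: simple_graph_def star_graph_def card_2_iff)

lemma simple_induced_subgraph: "simple_graph G \<Longrightarrow> simple_graph (induced_subgraph G W)"
  by (auto simp: simple_graph_def induced_subgraph_def)

text \<open>One half of the description of star forests by edges having an end of degree one. In a
  star, the edge \<open>{0, i}\<close> is the only one at \<open>i\<close>; the vertex mapped to
  \<open>i\<close> inherits this.\<close>

lemma leaf_if_star_forest:
  assumes G: "simple_graph G" "star_forest G" and e: "e \<in> edges G"
  shows "\<exists>x\<in>e. \<forall>d\<in>edges G. x \<in> d \<longrightarrow> d = e"
proof -
  obtain u v where uv: "e = {u, v}" "u \<noteq> v" "u \<in> verts G" "v \<in> verts G"
    using simple_graph_edgeE[OF G(1) e] .
  define W where "W = (adjacency G)\<^sup>* `` {u}"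
  define C where "C = induced_subgraph G W"
  have "C \<in> components G"
    using uv by (auto simp: components_def C_def W_def)
  then obtain m f where f: "graph_isomorphism f C (star_graph m)"
    using G(2) unfolding star_forest_def graph_isomorphic_def by blast
  have sC: "simple_graph C"
    using G(1) by (simp add: C_def simple_induced_subgraph)
  have inj: "inj_on f (verts C)" and E: "(`) f ` edges C = edges (star_graph m)"
    using f graph_isomorphism_iff_image[OF sC simple_star_graph] by blast+
  \<comment> \<open>An edge that meets the component lies inside it, so a vertex of degree one in
    the component has degree one in \<open>G\<close>.\<close>
  have sub: "d \<in> edges C" if d: "d \<in> edges G" "x \<in> d" and x: "x \<in> W" for d x
  proof -
    obtain y z where yz: "d = {y, z}"
      using simple_graph_edgeE[OF G(1) d(1)] by metis
    then have "(y, z) \<in> adjacency G" "(z, y) \<in> adjacency G"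
      using d(1) by (auto simp: adjacency_def insert_commute)
    then have "y \<in> W" "z \<in> W"
      using x d(2) yz by (auto simp: W_def intro: rtrancl_into_rtrancl)
    then show ?thesis
      using d(1) yz by (simp add: C_def induced_subgraph_def)
  qed
  have eC: "e \<in> edges C"
    using sub[OF e, of u] uv by (simp add: W_def)
  then have eW: "e \<subseteq> W"
    by (simp add: C_def induced_subgraph_def)
  have "f ` e \<in> edges (star_graph m)"
    using eC E by blast
  then obtain i where i: "f ` e = {0, i}" "1 \<le> i"
    by (auto simp: star_graph_def)
  then obtain x where x: "x \<in> e" "f x = i"
    by (metis imageE insertI1 insert_commute)
  have "d = e" if d: "d \<in> edges G" "x \<in> d" for d
  proof -
    have dC: "d \<in> edges C"
      using sub[OF d] x(1) eW by blast
    then have "f ` d \<in> edges (star_graph m)"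
      using E by blast
    moreover have "i \<in> f ` d"
      using x d by blast
    moreover have star: "s = {0, i}" if "s \<in> edges (star_graph m)" "i \<in> s" for s
      using i(2) that by (auto simp: star_graph_def)
    ultimately have "f ` d = {0, i}" by (intro star)
    then have "f ` d = f ` e" using i by simp
    then show ?thesis
      using inj_on_image_eq_iff[OF inj] simple_graph_edge_subset[OF sC dC]
        simple_graph_edge_subset[OF sC eC] by simp
  qed
  with x(1) show ?thesis by blast
qed

text \<open>Take an edge at \<open>v\<close> with degree-one end \<open>l\<close> and other end
  \<open>c\<close>. All neighbours of \<open>c\<close> turn out to have degree one, so the component
  of \<open>v\<close> is the star around \<open>c\<close>.\<close>

lemma star_forest_if_leaf:
  assumes fin: "finite_simple_graph G" and ne: "edges G \<noteq> {}"
    and iso: "\<not> (\<exists>v. isolated_vertex G v)"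
    and leaf: "\<And>e. e \<in> edges G \<Longrightarrow> \<exists>x\<in>e. \<forall>d\<in>edges G. x \<in> d \<longrightarrow> d = e"
  shows "star_forest G"
  unfolding star_forest_def
proof (intro conjI ballI)
  have G: "simple_graph G" and finV: "finite (verts G)"
    using fin by (auto simp: finite_simple_graph_def)
  fix C assume "C \<in> components G"
  then obtain v where v: "v \<in> verts G" and C: "C = induced_subgraph G ((adjacency G)\<^sup>* `` {v})"
    by (auto simp: components_def)
  obtain e where e: "e \<in> edges G" "v \<in> e"
    using iso v by (auto simp: isolated_vertex_def)
  obtain l where l: "l \<in> e" "\<And>d. d \<in> edges G \<Longrightarrow> l \<in> d \<Longrightarrow> d = e"
    using leaf[OF e(1)] by blast
  obtain c where c: "e = {c, l}" "c \<noteq> l"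
    using simple_graph_edgeE[OF G e(1)] l(1) by (metis doubleton_eq_iff empty_iff insert_iff)
  define N where "N = {x. {c, x} \<in> edges G}"
  have sub: "c \<in> verts G" "N \<subseteq> verts G" and cN: "c \<notin> N" and lN: "l \<in> N"
    using simple_graph_edge_subset[OF G] e(1) c G by (auto simp: N_def simple_graph_def)
  \<comment> \<open>For \<open>x\<close> other than \<open>l\<close>, the centre \<open>c\<close>
    also lies on \<open>e\<close>, so the degree-one end of \<open>{c, x}\<close> must be
    \<open>x\<close>. The vertex \<open>l\<close> is treated separately because
    \<open>{c, l}\<close> may be the whole component.\<close>
  have N_leaf: "d = {c, x}" if "x \<in> N" "d \<in> edges G" "x \<in> d" for x d
  proof (cases "x = l")
    case True
    then show ?thesis using l(2) that c by blast
  next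
    case False
    have cx: "{c, x} \<in> edges G" using that by (simp add: N_def)
    then obtain y where y: "y \<in> {c, x}" "\<And>d. d \<in> edges G \<Longrightarrow> y \<in> d \<Longrightarrow> d = {c, x}"
      using leaf by blast
    have "y \<noteq> c"
      using y(2)[OF e(1)] c False by auto
    with y that show ?thesis by blast
  qed
  \<comment> \<open>The set is closed under adjacency: from \<open>c\<close> one reaches only
    \<open>N\<close>, and from \<open>N\<close> only \<open>c\<close>.\<close>
  have W: "(adjacency G)\<^sup>* `` {v} = insert c N"
  proof (intro equalityI subsetI)
    fix x assume "x \<in> (adjacency G)\<^sup>* `` {v}"
    then have "(v, x) \<in> (adjacency G)\<^sup>*" by simp
    then show "x \<in> insert c N"
    proof (induction rule: rtrancl_induct)
      case base
      then show ?case using e(2) c lN by auto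
    next
      case (step y z)
      then have yz: "{y, z} \<in> edges G" by (simp add: adjacency_def)
      show ?case
      proof (cases "y = c")
        case True
        then show ?thesis using yz by (simp add: N_def)
      next
        case False
        then have "{y, z} = {c, y}" using N_leaf[OF _ yz] step.IH by simp
        then show ?thesis using False by (auto simp: doubleton_eq_iff)
      qed
    qed
  next
    fix x assume x: "x \<in> insert c N"
    have "(v, c) \<in> (adjacency G)\<^sup>*"
      using e c by (auto simp: adjacency_def insert_commute)
    moreover have "x = c \<or> (c, x) \<in> adjacency G"
      using x by (auto simp: adjacency_def N_def)
    ultimately show "x \<in> (adjacency G)\<^sup>* `` {v}"
      by (auto intro: rtrancl_into_rtrancl)
  qed
  have vC: "verts C = insert c N"
    using sub by (auto simp: C W induced_subgraph_def)
  have eC: "edges C = (\<lambda>x. {c, x}) ` N"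
  proof (intro equalityI subsetI)
    fix d assume "d \<in> edges C"
    then have d: "d \<in> edges G" "d \<subseteq> insert c N"
      by (auto simp: C W induced_subgraph_def)
    obtain y z where "d = {y, z}" "y \<noteq> z" using simple_graph_edgeE[OF G d(1)] by metis
    with d(2) obtain x where "x \<in> N" "x \<in> d" by auto
    with N_leaf d(1) show "d \<in> (\<lambda>x. {c, x}) ` N" by blast
  qed (auto simp: C W induced_subgraph_def N_def)
  have finN: "finite N" using sub(2) finV finite_subset by blast
  define m where "m = card N"
  have "m \<ge> 1" using lN finN by (auto simp: m_def Suc_le_eq card_gt_0_iff)
  obtain h where h: "bij_betw h {1..m} N"
    using ex_bij_betw_nat_finite_1[OF finN] by (auto simp: m_def)
  define g where "g i = (if i = 0 then c else h i)" for i
  have atMost: "{..m} = insert 0 {1..m}" by auto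
  have "bij_betw g {1..m} N"
    using h bij_betw_cong[of "{1..m}" g h N] by (simp add: g_def)
  then have gh: "g ` {1..m} = N" "inj_on g {1..m}"
    by (auto simp: bij_betw_def)
  have "inj_on g (verts (star_graph m))" "g ` verts (star_graph m) = verts C"
    using gh cN by (auto simp: star_graph_def atMost vC g_def[of 0])
  moreover have "edges (star_graph m) = (\<lambda>i. {0, i}) ` {1..m}"
    by (auto simp: star_graph_def)
  then have "(`) g ` edges (star_graph m) = edges C"
    unfolding eC gh(1)[symmetric] by (simp add: image_image g_def[of 0])
  moreover have sC: "simple_graph C"
    using G by (simp add: C simple_induced_subgraph)
  ultimately have "graph_isomorphism g (star_graph m) C"
    using graph_isomorphism_iff_image[OF simple_star_graph sC] by blast
  from graph_isomorphism_the_inv_into[OF simple_star_graph sC this]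
  show "\<exists>m\<ge>1. graph_isomorphic C (star_graph m)"
    using \<open>m \<ge> 1\<close> by (auto simp: graph_isomorphic_def)
qed (rule ne)

section \<open>Paths and triangles\<close>

lemma path_graph_4: "verts (path_graph 4) = {0, 1, 2, 3}" "edges (path_graph 4) = {{0, 1}, {1, 2}, {2, 3}}"
proof -
  have *: "Suc i < 4 \<longleftrightarrow> i = 0 \<or> i = 1 \<or> i = 2" for i by arith
  show "verts (path_graph 4) = {0, 1, 2, 3}"
    by (auto simp: path_graph_def)
  show "edges (path_graph 4) = {{0, 1}, {1, 2}, {2, 3}}"
    unfolding path_graph_def * by (auto simp: numeral_eq_Suc)
qed

lemma complete_graph_3: "verts (complete_graph 3) = {0, 1, 2}" "edges (complete_graph 3) = {{0, 1}, {0, 2}, {1, 2}}"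
proof -
  show "verts (complete_graph 3) = {0, 1, 2}"
    by (auto simp: complete_graph_def)
  then have *: "{..<3} = {0, 1, 2::nat}" by (simp add: complete_graph_def)
  show "edges (complete_graph 3) = {{0, 1}, {0, 2}, {1, 2}}"
  proof (intro equalityI subsetI)
    fix e assume "e \<in> edges (complete_graph 3)"
    then obtain x y where "e = {x, y}" "x \<noteq> y" "{x, y} \<subseteq> {0, 1, 2}"
      unfolding complete_graph_def * by (auto simp: card_2_iff)
    then show "e \<in> {{0, 1}, {0, 2}, {1, 2}}" by auto
  qed (auto simp: complete_graph_def)
qed

lemma simple_path_graph_4: "simple_graph (path_graph 4)"
  by (simp add: simple_graph_def path_graph_4)

lemma simple_complete_graph_3: "simple_graph (complete_graph 3)"
  by (simp add: simple_graph_def complete_graph_3)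

lemma graph_isomorphic_path_graph_4_iff:
  assumes "simple_graph G"
  shows "graph_isomorphic G (path_graph 4) \<longleftrightarrow>
    (\<exists>a b c d. distinct [a, b, c, d] \<and> verts G = {a, b, c, d} \<and> edges G = {{a, b}, {b, c}, {c, d}})"
proof
  assume "graph_isomorphic G (path_graph 4)"
  then obtain g where "graph_isomorphism g (path_graph 4) G"
    using graph_isomorphism_the_inv_into[OF assms simple_path_graph_4]
    by (auto simp: graph_isomorphic_def)
  then have "inj_on g {0, 1, 2, 3}" "verts G = {g 0, g 1, g 2, g 3}"
    "edges G = {{g 0, g 1}, {g 1, g 2}, {g 2, g 3}}"
    using graph_isomorphism_iff_image[OF simple_path_graph_4 assms, of g] by (auto simp: path_graph_4)
  then show "\<exists>a b c d. distinct [a, b, c, d] \<and> verts G = {a, b, c, d} \<and>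
      edges G = {{a, b}, {b, c}, {c, d}}"
    by (intro exI[of _ "g 0"] exI[of _ "g 1"] exI[of _ "g 2"] exI[of _ "g 3"]) (auto simp: inj_on_def)
next
  assume "\<exists>a b c d. distinct [a, b, c, d] \<and> verts G = {a, b, c, d} \<and>
      edges G = {{a, b}, {b, c}, {c, d}}"
  then obtain a b c d where abcd: "distinct [a, b, c, d]" "verts G = {a, b, c, d}"
    "edges G = {{a, b}, {b, c}, {c, d}}" by blast
  have "graph_isomorphism (\<lambda>i::nat. [a, b, c, d] ! i) (path_graph 4) G"
    unfolding graph_isomorphism_iff_image[OF simple_path_graph_4 assms] path_graph_4
    using abcd by (simp add: numeral_2_eq_2 numeral_3_eq_3)
  from graph_isomorphism_the_inv_into[OF simple_path_graph_4 assms this]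
  show "graph_isomorphic G (path_graph 4)"
    by (auto simp: graph_isomorphic_def)
qed

lemma graph_isomorphic_complete_graph_3_iff:
  assumes "simple_graph G"
  shows "graph_isomorphic G (complete_graph 3) \<longleftrightarrow>
    (\<exists>a b c. distinct [a, b, c] \<and> verts G = {a, b, c} \<and> edges G = {{a, b}, {a, c}, {b, c}})"
proof
  assume "graph_isomorphic G (complete_graph 3)"
  then obtain g where "graph_isomorphism g (complete_graph 3) G"
    using graph_isomorphism_the_inv_into[OF assms simple_complete_graph_3]
    by (auto simp: graph_isomorphic_def)
  then have "inj_on g {0, 1, 2}" "verts G = {g 0, g 1, g 2}"
    "edges G = {{g 0, g 1}, {g 0, g 2}, {g 1, g 2}}"
    using graph_isomorphism_iff_image[OF simple_complete_graph_3 assms, of g]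
    by (auto simp: complete_graph_3)
  then show "\<exists>a b c. distinct [a, b, c] \<and> verts G = {a, b, c} \<and> edges G = {{a, b}, {a, c}, {b, c}}"
    by (intro exI[of _ "g 0"] exI[of _ "g 1"] exI[of _ "g 2"]) (auto simp: inj_on_def)
next
  assume "\<exists>a b c. distinct [a, b, c] \<and> verts G = {a, b, c} \<and> edges G = {{a, b}, {a, c}, {b, c}}"
  then obtain a b c where abc: "distinct [a, b, c]" "verts G = {a, b, c}"
    "edges G = {{a, b}, {a, c}, {b, c}}" by blast
  have "graph_isomorphism (\<lambda>i::nat. [a, b, c] ! i) (complete_graph 3) G"
    unfolding graph_isomorphism_iff_image[OF simple_complete_graph_3 assms] complete_graph_3
    using abc by (simp add: numeral_2_eq_2)
  from graph_isomorphism_the_inv_into[OF simple_complete_graph_3 assms this]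
  show "graph_isomorphic G (complete_graph 3)"
    by (auto simp: graph_isomorphic_def)
qed

section \<open>Graphs other than star forests, the path and the triangle\<close>

lemma chi_plus_eq_infinity_if_not_exceptional:
  assumes fin: "finite_simple_graph G" and ne: "edges G \<noteq> {}"
    and iso: "\<not> (\<exists>v. isolated_vertex G v)"
    and not: "\<not> star_forest G" "\<not> graph_isomorphic G (path_graph 4)"
      "\<not> graph_isomorphic G (complete_graph 3)"
  shows "chi_plus G = \<infinity>"
proof -
  have G: "simple_graph G" using fin by (simp add: finite_simple_graph_def)
  obtain e where e: "e \<in> edges G" "\<And>x. x \<in> e \<Longrightarrow> \<exists>d\<in>edges G. x \<in> d \<and> d \<noteq> e"
    using star_forest_if_leaf[OF fin ne iso] not(1) by blast
  obtain u v where uv: "e = {u, v}" "u \<noteq> v"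
    using simple_graph_edgeE[OF G e(1)] by metis
  have nbr: "\<exists>x. {u, x} \<in> edges G \<and> x \<noteq> u \<and> x \<noteq> v" if uv: "e = {u, v}" for u v
  proof -
    obtain d where d: "d \<in> edges G" "u \<in> d" "d \<noteq> e" using e(2)[of u] uv by blast
    obtain y z where "d = {y, z}" "y \<noteq> z" using simple_graph_edgeE[OF G d(1)] by metis
    with d uv show ?thesis by (auto simp: insert_commute)
  qed
  obtain x y where x: "{u, x} \<in> edges G" "x \<noteq> u" "x \<noteq> v" and y: "{v, y} \<in> edges G" "y \<noteq> u" "y \<noteq> v"
    using nbr[of u v] nbr[of v u] uv by (auto simp: insert_commute)
  \<comment> \<open>With only these three edges and no isolated vertex, \<open>G\<close> is a
    triangle if \<open>x = y\<close> and the path \<open>x, u, v, y\<close> otherwise.\<close>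
  have "\<exists>h\<in>edges G. h \<notin> {{u, v}, {u, x}, {v, y}}"
  proof (rule ccontr)
    assume "\<not> ?thesis"
    then have E: "edges G = {{u, v}, {u, x}, {v, y}}"
      using e(1) uv x y by auto
    have "verts G = \<Union> (edges G)"
      using iso simple_graph_edge_subset[OF G] by (auto simp: isolated_vertex_def)
    then have V: "verts G = {x, u, v, y}" using E by auto
    show False
    proof (cases "x = y")
      case True
      then have "distinct [u, v, x]" "verts G = {u, v, x}" "edges G = {{u, v}, {u, x}, {v, x}}"
        using E V x y uv by auto
      then show False
        using not(3) graph_isomorphic_complete_graph_3_iff[OF G] by blast
    next
      case False
      then have "distinct [x, u, v, y]" "edges G = {{x, u}, {u, v}, {v, y}}"
        using E x y uv by (auto simp: insert_commute)
      then show False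
        using not(2) V graph_isomorphic_path_graph_4_iff[OF G] by blast
    qed
  qed
  then obtain h where h: "h \<in> edges G" "h \<noteq> {u, v}" "h \<noteq> {u, x}" "h \<noteq> {v, y}" by blast
  \<comment> \<open>An edge through both \<open>u\<close> and \<open>v\<close> would be
    \<open>{u, v}\<close>. The two cases differ only by exchanging \<open>u\<close> with
    \<open>v\<close> and \<open>x\<close> with \<open>y\<close>.\<close>
  have "u \<notin> h \<or> v \<notin> h"
  proof -
    obtain a b where "h = {a, b}" using simple_graph_edgeE[OF G h(1)] by metis
    with h(2) uv(2) show ?thesis by auto
  qed
  then show ?thesis
  proof
    assume "u \<notin> h"
    with h show ?thesis
      using e(1) uv x y
      by (intro chi_plus_eq_infinity_if_four_edges[OF fin iso, of u v "{u, x}" "{v, y}" h]) auto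
  next
    assume "v \<notin> h"
    with h show ?thesis
      using e(1) uv x y
      by (intro chi_plus_eq_infinity_if_four_edges[OF fin iso, of v u "{v, y}" "{u, x}" h])
        (auto simp: insert_commute)
  qed
qed

section \<open>Canonical orderings of complete bipartite graphs\<close>

text \<open>Shifting the second side by \<open>N\<close> lets both sides be indexed by
  \<open>{..<N}\<close>, so that one Ramsey argument on this set controls both.\<close>

definition complete_bipartite :: "nat \<Rightarrow> nat sgraph" where
  "complete_bipartite N = \<lparr>verts = {..<2 * N}, edges = {{i, N + j} | i j. i < N \<and> j < N}\<rparr>"

lemma finite_simple_complete_bipartite: "finite_simple_graph (complete_bipartite N)"
  by (auto simp: finite_simple_graph_def simple_graph_def complete_bipartite_def card_2_iff)

lemma chromatic_number_complete_bipartite_le: "chromatic_number (complete_bipartite N) \<le> 2"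
proof (rule chromatic_number_le)
  show "proper_colouring (complete_bipartite N) 2 (\<lambda>v. if v < N then 0 else 1)"
    by (auto simp: proper_colouring_def complete_bipartite_def doubleton_eq_iff)
qed

text \<open>The vertices \<open>p i\<close> form the major side: edges are sorted by their index on
  it. The order among edges at the same \<open>p i\<close> is left free; an embedding either uses
  each major vertex once or adapts to that order.\<close>

definition major_ordered :: "'v sgraph \<Rightarrow> 'v set rel \<Rightarrow> nat \<Rightarrow> (nat \<Rightarrow> 'v) \<Rightarrow> (nat \<Rightarrow> 'v) \<Rightarrow> bool" where
  "major_ordered K L m p q \<longleftrightarrow>
     inj_on p {..<m} \<and> inj_on q {..<m} \<and>
     (\<forall>i<m. \<forall>j<m. p i \<noteq> q j \<and> {p i, q j} \<in> edges K) \<and>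
     (\<forall>i' i j j'. i < i' \<longrightarrow> i' < m \<longrightarrow> j < m \<longrightarrow> j' < m \<longrightarrow> ({p i, q j}, {p i', q j'}) \<in> L)"

text \<open>Dropping every other major vertex leaves room for an intermediate edge, which yields the
  comparison of edges sharing a minor vertex.\<close>

lemma major_ordered_even:
  assumes "trans L" "inj_on a {..<Suc (2 * m)}" "inj_on b {..<Suc (2 * m)}"
    and edge: "\<And>x y. x < Suc (2 * m) \<Longrightarrow> y < Suc (2 * m) \<Longrightarrow> a x \<noteq> b y \<and> {a x, b y} \<in> edges K"
    and less: "\<And>x x' y y'. x < x' \<Longrightarrow> x' < Suc (2 * m) \<Longrightarrow> y < Suc (2 * m) \<Longrightarrow> y' < Suc (2 * m) \<Longrightarrow>
      y \<noteq> y' \<Longrightarrow> ({a x, b y}, {a x', b y'}) \<in> L"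
  shows "major_ordered K L m (\<lambda>i. a (2 * i)) b"
  unfolding major_ordered_def
proof (intro conjI allI impI)
  show "inj_on (\<lambda>i. a (2 * i)) {..<m}"
  proof (rule inj_onI)
    fix i j assume "i \<in> {..<m}" "j \<in> {..<m}" "a (2 * i) = a (2 * j)"
    then show "i = j" using inj_onD[OF assms(2), of "2 * i" "2 * j"] by simp
  qed
  show "inj_on b {..<m}"
    using assms(3) by (rule inj_on_subset) auto
  fix i i' j j' assume "i < i'" "i' < m" "j < m" "j' < m"
  \<comment> \<open>The index \<open>m\<close> differs from both \<open>j\<close> and
    \<open>j'\<close>, so each half of the detour changes the minor vertex too and
    \<open>less\<close> applies. The odd major index lies strictly between the two even
    ones.\<close>
  then have "({a (2 * i), b j}, {a (Suc (2 * i)), b m}) \<in> L"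
    "({a (Suc (2 * i)), b m}, {a (2 * i'), b j'}) \<in> L"
    by (intro less; simp)+
  with \<open>trans L\<close> show "({a (2 * i), b j}, {a (2 * i'), b j'}) \<in> L"
    by (rule transD)
qed (use edge in auto)

text \<open>Ramsey's theorem for quadruples \<open>x < x' < y < y'\<close>, coloured by how the two perfect matchings
  between \<open>{x, x'}\<close> and \<open>{y, y'}\<close> are ordered.\<close>

lemma ex_major_ordered:
  obtains N where "\<And>L. edge_ordering (complete_bipartite N) L \<Longrightarrow>
    \<exists>p q. major_ordered (complete_bipartite N) L m p q"
proof -
  \<comment> \<open>The size \<open>2 * m + 1\<close> is what \<open>major_ordered_even\<close> asks
    for; a homogeneous set of size \<open>2 * n\<close> supplies \<open>n\<close> vertices for each
    side.\<close>
  define n where "n = Suc (2 * m)"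
  obtain N :: nat where N: "partn_lst {..<N} [2 * n, 2 * n, 2 * n, 2 * n] 4"
    using ramsey_full[of "[2 * n, 2 * n, 2 * n, 2 * n]" 4] by blast
  have "\<exists>p q. major_ordered (complete_bipartite N) L m p q"
    if L: "edge_ordering (complete_bipartite N) L" for L
  proof -
    let ?K = "complete_bipartite N"
    define E where "E i j = {i, N + j}" for i j
    \<comment> \<open>The two bits of the colour: 1 if the parallel matching increases with the
      first endpoint, 2 if the crossing matching does.\<close>
    define colour where "colour S = (let xs = sorted_list_of_set S in
      (if (E (xs ! 0) (xs ! 2), E (xs ! 1) (xs ! 3)) \<in> L then 1 else 0) +
      (if (E (xs ! 0) (xs ! 3), E (xs ! 1) (xs ! 2)) \<in> L then 2 else 0 :: nat))" for S
    have colour: "colour \<in> nsets {..<N} 4 \<rightarrow> {..<4}"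
      by (auto simp: colour_def Let_def)
    have len: "length [2 * n, 2 * n, 2 * n, 2 * n] = 4" by simp
    obtain c H where c: "c < length [2 * n, 2 * n, 2 * n, 2 * n]"
      "H \<in> nsets {..<N} ([2 * n, 2 * n, 2 * n, 2 * n] ! c)" "colour ` nsets H 4 \<subseteq> {c}"
      by (rule partn_lstE[OF N colour len])
    have "[2 * n, 2 * n, 2 * n, 2 * n] ! c = 2 * n"
      using c(1) by (auto simp: less_Suc_eq numeral_eq_Suc)
    with c(2) have H: "H \<subseteq> {..<N}" "finite H" "card H = 2 * n"
      by (auto simp: nsets_def)
    define h where "h t = sorted_list_of_set H ! t" for t
    have h_less: "h s < h t" if "s < t" "t < 2 * n" for s t
      unfolding h_def using that H strict_sorted_list_of_set[of H]
      by (intro sorted_wrt_nth_less[where P = "(<)"]) auto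
    have h_mem: "h t \<in> H" if "t < 2 * n" for t
      unfolding h_def using that H by (metis length_sorted_list_of_set nth_mem set_sorted_list_of_set)
    have h_N: "h t < N" if "t < 2 * n" for t
      using h_mem[OF that] H by auto
    \<comment> \<open>The lower half of the homogeneous set indexes \<open>A\<close> and the upper
      half \<open>B\<close>, so every quadruple of two \<open>A\<close>-indices and two
      \<open>B\<close>-indices is increasing in the required pattern.\<close>
    define A where "A = h"
    define B where "B y = N + h (n + y)" for y
    have col: "({A x, B y}, {A x', B y'}) \<in> L \<longleftrightarrow> c \<in> {1, 3}"
      "({A x, B y'}, {A x', B y}) \<in> L \<longleftrightarrow> c \<in> {2, 3}"
      if "x < x'" "x' < n" "y < y'" "y' < n" for x x' y y'
    proof -
      let ?xs = "[h x, h x', h (n + y), h (n + y')]"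
      have lt: "h x < h x'" "h x' < h (n + y)" "h (n + y) < h (n + y')"
        using that by (auto intro!: h_less)
      then have xs: "sorted_list_of_set (set ?xs) = ?xs"
        by (intro sorted_list_of_set.idem_if_sorted_distinct) auto
      have "set ?xs \<in> nsets H 4"
        using lt h_mem that by (auto simp: nsets_def)
      then have "colour (set ?xs) = c" using c(3) by (auto simp: image_subset_iff)
      then show "({A x, B y}, {A x', B y'}) \<in> L \<longleftrightarrow> c \<in> {1, 3}"
        "({A x, B y'}, {A x', B y}) \<in> L \<longleftrightarrow> c \<in> {2, 3}"
        unfolding colour_def xs Let_def by (auto simp: E_def A_def B_def split: if_splits)
    qed
    have edge: "A x \<noteq> B y \<and> {A x, B y} \<in> edges ?K" if "x < n" "y < n" for x y
      using that h_N[of x] h_N[of "n + y"] by (auto simp: A_def B_def complete_bipartite_def)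
    have BA: "{B x, A y} = {A y, B x}" for x y by auto
    have edge': "B x \<noteq> A y \<and> {B x, A y} \<in> edges ?K" if "x < n" "y < n" for x y
      using edge[OF that(2,1)] by (auto simp: BA)
    have rev: "(e, d) \<in> L" if "(d, e) \<notin> L" "d \<in> edges ?K" "e \<in> edges ?K" for d e
      using edge_orderingD(4)[OF L] that by blast
    \<comment> \<open>The colour decides every comparison between disjoint edges. A missing bit
      reverses the comparison by totality.\<close>
    have AB: "({A x, B y}, {A x', B y'}) \<in> L"
      if "x < n" "x' < n" "y < n" "y' < n"
        "(x < x' \<and> y < y' \<and> c \<in> {1, 3}) \<or> (x < x' \<and> y' < y \<and> c \<in> {2, 3}) \<or>
         (x' < x \<and> y' < y \<and> c \<notin> {1, 3}) \<or> (x' < x \<and> y < y' \<and> c \<notin> {2, 3})" for x x' y y'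
      using that(5)
    proof (elim disjE conjE)
      assume "x < x'" "y < y'" "c \<in> {1, 3}"
      then show ?thesis using col(1) that by blast
    next
      assume "x < x'" "y' < y" "c \<in> {2, 3}"
      then show ?thesis using col(2) that by blast
    next
      assume "x' < x" "y' < y" "c \<notin> {1, 3}"
      then show ?thesis using col(1)[of x' x y' y] that edge by (intro rev) auto
    next
      assume "x' < x" "y < y'" "c \<notin> {2, 3}"
      then show ?thesis using col(2)[of x' x y y'] that edge by (intro rev) auto
    qed
    have inj_h: "inj_on h {..<2 * n}"
      by (rule inj_onI) (metis h_less lessThan_iff less_irrefl linorder_neqE_nat)
    then have injA: "inj_on A {..<n}"
      unfolding A_def by (rule inj_on_subset) auto
    have injB: "inj_on B {..<n}"
    proof (rule inj_onI)
      fix x y assume "x \<in> {..<n}" "y \<in> {..<n}" "B x = B y"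
      then show "x = y" using inj_onD[OF inj_h, of "n + x" "n + y"] by (simp add: B_def)
    qed
    \<comment> \<open>Reversal of the indices, for the two colours under which the major side is
      sorted downwards.\<close>
    define r where "r x = 2 * m - x" for x
    have r: "r x < n" "x < n \<Longrightarrow> x' < n \<Longrightarrow> r x < r x' \<longleftrightarrow> x' < x" for x x'
      by (auto simp: r_def n_def)
    have inj_r: "inj_on r {..<n}" "r ` {..<n} \<subseteq> {..<n}"
      by (auto simp: inj_on_def r_def n_def)
    have injAr: "inj_on (\<lambda>x. A (r x)) {..<n}" and injBr: "inj_on (\<lambda>x. B (r x)) {..<n}"
      using inj_r comp_inj_on[OF inj_r(1) inj_on_subset[OF injA inj_r(2)]]
        comp_inj_on[OF inj_r(1) inj_on_subset[OF injB inj_r(2)]] by (auto simp: comp_def)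
    note even = major_ordered_even[OF edge_orderingD(2)[OF L], where m = m and K = ?K, folded n_def]
    \<comment> \<open>If the bits agree, the \<open>A\<close>-endpoint decides, upwards for 3 and
      downwards for 0. If they differ, the \<open>B\<close>-endpoint decides, upwards for 1 and
      downwards for 2.\<close>
    consider "c = 3" | "c = 0" | "c = 1" | "c = 2" using c(1)[unfolded len] by linarith
    then show ?thesis
    proof cases
      case 1
      have "major_ordered ?K L m (\<lambda>i. A (2 * i)) B"
      proof (rule even[where a = "A" and b = B, OF injA injB])
        fix x x' y y' assume "x < x'" "x' < n" "y < n" "y' < n" "y \<noteq> y'"
        with 1 show "({(A) x, B y}, {(A) x', B y'}) \<in> L"
          unfolding BA using r by (intro AB) auto
      qed (use edge r in simp)
      then show ?thesis by blast
    next
      case 2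
      have "major_ordered ?K L m (\<lambda>i. A (r (2 * i))) B"
      proof (rule even[where a = "\<lambda>x. A (r x)" and b = B, OF injAr injB])
        fix x x' y y' assume "x < x'" "x' < n" "y < n" "y' < n" "y \<noteq> y'"
        with 2 show "({(\<lambda>x. A (r x)) x, B y}, {(\<lambda>x. A (r x)) x', B y'}) \<in> L"
          unfolding BA using r by (intro AB) auto
      qed (use edge r in simp)
      then show ?thesis by blast
    next
      case 3
      have "major_ordered ?K L m (\<lambda>i. B (2 * i)) A"
      proof (rule even[where a = "B" and b = A, OF injB injA])
        fix x x' y y' assume "x < x'" "x' < n" "y < n" "y' < n" "y \<noteq> y'"
        with 3 show "({(B) x, A y}, {(B) x', A y'}) \<in> L"
          unfolding BA using r by (intro AB) auto
      qed (use edge' r in simp)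
      then show ?thesis by blast
    next
      case 4
      have "major_ordered ?K L m (\<lambda>i. B (r (2 * i))) A"
      proof (rule even[where a = "\<lambda>x. B (r x)" and b = A, OF injBr injA])
        fix x x' y y' assume "x < x'" "x' < n" "y < n" "y' < n" "y \<noteq> y'"
        with 4 show "({(\<lambda>x. B (r x)) x, A y}, {(\<lambda>x. B (r x)) x', A y'}) \<in> L"
          unfolding BA using r by (intro AB) auto
      qed (use edge' r in simp)
      then show ?thesis by blast
    qed
  qed
  with that show ?thesis by blast
qed

section \<open>Order chromatic number two from canonical orderings\<close>

lemma two_le_chromatic_number_if_not_can_avoid:
  assumes "finite_simple_graph K" "simple_graph H" "edges H \<noteq> {}" "edge_ordering H M"
    "\<not> can_avoid K H M"
  shows "2 \<le> chromatic_number K"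
proof -
  obtain \<phi> where "\<And>e. e \<in> edges H \<Longrightarrow> \<phi> ` e \<in> edges K"
    using embedding_if_not_can_avoid[OF assms(1,2,4,5)] by blast
  with assms(3) have "edges K \<noteq> {}" by blast
  with assms(1) show ?thesis by (rule two_le_chromatic_number)
qed

text \<open>Reduces the upper bound to an embedding into one canonically ordered piece: Ramsey finds
  such a piece in every ordering of a large complete bipartite graph, which is 2-colourable.\<close>

lemma order_chromatic_number_eq_2:
  assumes H: "simple_graph H" "edges H \<noteq> {}" and M: "edge_ordering H M"
    and cont: "\<And>(K :: nat sgraph) L p q. simple_graph K \<Longrightarrow> edge_ordering K L \<Longrightarrow>
      major_ordered K L m p q \<Longrightarrow> eo_contains K L H M"
  shows "order_chromatic_number H M = 2"
proof -
  obtain N where N: "\<And>L. edge_ordering (complete_bipartite N) L \<Longrightarrow>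
      \<exists>p q. major_ordered (complete_bipartite N) L m p q"
    using ex_major_ordered[of m] by blast
  have "simple_graph (complete_bipartite N)"
    using finite_simple_complete_bipartite by (simp add: finite_simple_graph_def)
  then have "\<not> can_avoid (complete_bipartite N) H M"
    using cont N unfolding can_avoid_def by blast
  then have "order_chromatic_number H M = enat 2"
    using finite_simple_complete_bipartite chromatic_number_complete_bipartite_le
      two_le_chromatic_number_if_not_can_avoid[OF _ H M]
    by (intro order_chromatic_number_eqI) blast+
  then show ?thesis by (simp add: numeral_eq_enat)
qed

lemma major_orderedD:
  assumes "simple_graph K" "major_ordered K L m p q"
  shows "inj_on p {..<m}" "inj_on q {..<m}"
    "\<And>i j. i < m \<Longrightarrow> j < m \<Longrightarrow> p i \<noteq> q j"
    "\<And>i j. i < m \<Longrightarrow> j < m \<Longrightarrow> {p i, q j} \<in> edges K"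
    "\<And>i i' j j'. i < i' \<Longrightarrow> i' < m \<Longrightarrow> j < m \<Longrightarrow> j' < m \<Longrightarrow> ({p i, q j}, {p i', q j'}) \<in> L"
    "\<And>i. i < m \<Longrightarrow> p i \<in> verts K" "\<And>i. i < m \<Longrightarrow> q i \<in> verts K"
proof -
  show edge: "{p i, q j} \<in> edges K" if "i < m" "j < m" for i j
    using assms(2) that by (auto simp: major_ordered_def)
  show "p i \<in> verts K" "q i \<in> verts K" if "i < m" for i
    using simple_graph_edge_subset[OF assms(1) edge[OF that that]] by auto
qed (use assms(2) in \<open>auto simp: major_ordered_def\<close>)

section \<open>Star forests, the path and the triangle\<close>

text \<open>Each edge has a private degree-one end. Sending it to the major vertex indexed by the
  rank of the edge, and all other vertices to the minor side, makes the host order follow the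
  ranks.\<close>

lemma eo_contains_if_star_forest:
  assumes G: "finite_simple_graph G" "star_forest G" and M: "edge_ordering G M"
    and K: "simple_graph K" "edge_ordering K L"
    and pq: "major_ordered K L (Suc (card (edges G) + card (verts G))) p q"
  shows "eo_contains K L G M"
proof -
  define m where "m = Suc (card (edges G) + card (verts G))"
  note pq = major_orderedD[OF K(1) pq, folded m_def]
  have sG: "simple_graph G" and finV: "finite (verts G)"
    using G by (auto simp: finite_simple_graph_def)
  have finE: "finite (edges G)" using G(1) by (rule finite_edges)
  have "\<forall>e\<in>edges G. \<exists>x. x \<in> e \<and> (\<forall>d\<in>edges G. x \<in> d \<longrightarrow> d = e)"
    using leaf_if_star_forest[OF sG G(2)] by blast
  then obtain leaf where leaf: "\<And>e. e \<in> edges G \<Longrightarrow> leaf e \<in> e"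
    and uniq: "\<And>d e. e \<in> edges G \<Longrightarrow> d \<in> edges G \<Longrightarrow> leaf e \<in> d \<Longrightarrow> d = e"
    by metis
  have inj_leaf: "inj_on leaf (edges G)"
    using leaf uniq by (metis inj_onI)
  obtain g and n :: nat where g: "g ` verts G = {i. i < n}" "inj_on g (verts G)"
    using finite_imp_inj_to_nat_seg[OF finV] by metis
  have "n = card (verts G)" using card_image[OF g(2)] g(1) by simp
  then have g_less: "g v < m" if "v \<in> verts G" for v
    using imageI[OF that, of g] g(1) by (simp add: m_def)
  \<comment> \<open>The rank counts the edge itself and can reach \<open>card (edges G)\<close>; the
    \<open>Suc\<close> in \<open>m\<close> leaves room for this.\<close>
  define r where "r e = card {d \<in> edges G. (d, e) \<in> M}" for e
  have r_less: "r e < m" for e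
    using card_mono[OF finE, of "{d \<in> edges G. (d, e) \<in> M}"] by (auto simp: r_def m_def)
  have r_mono: "r d < r e" if "(d, e) \<in> M" "d \<noteq> e" for d e
  proof -
    have "d \<in> edges G" "e \<in> edges G" using that edge_orderingD(1)[OF M] by auto
    then have "e \<in> {d \<in> edges G. (d, e) \<in> M} - {d' \<in> edges G. (d', d) \<in> M}"
      using that edge_orderingD(3,4)[OF M] by (auto dest: antisymD)
    moreover have "{d' \<in> edges G. (d', d) \<in> M} \<subseteq> {d \<in> edges G. (d, e) \<in> M}"
      using that edge_orderingD(2)[OF M] by (auto dest: transD)
    ultimately show ?thesis
      unfolding r_def using finE by (intro psubset_card_mono) auto
  qed
  have inj_r: "inj_on r (edges G)"
    using r_mono edge_orderingD(4)[OF M] by (metis inj_onI less_irrefl)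
  define \<phi> where "\<phi> v = (if v \<in> leaf ` edges G then p (r (the_inv_into (edges G) leaf v)) else q (g v))" for v
  have \<phi>_leaf: "\<phi> (leaf e) = p (r e)" if "e \<in> edges G" for e
    using that inj_leaf by (simp add: \<phi>_def the_inv_into_f_f)
  have \<phi>_centre: "\<phi> v = q (g v)" if "v \<notin> leaf ` edges G" for v
    using that by (simp add: \<phi>_def)
  have \<phi>_edge: "\<exists>j<m. \<phi> ` e = {p (r e), q j}" if e: "e \<in> edges G" for e
  proof -
    obtain c where c: "e = {leaf e, c}" "c \<noteq> leaf e" "c \<in> verts G"
      using simple_graph_edgeE[OF sG e] leaf[OF e] by (metis doubleton_eq_iff empty_iff insert_iff)
    \<comment> \<open>If \<open>c\<close> were the chosen leaf of some edge, that edge would be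
      \<open>e\<close>, whose chosen leaf is the other end. In a single-edge component only one of
      the two ends is chosen.\<close>
    then have "c \<notin> leaf ` edges G" using uniq e by blast
    then have "\<phi> ` e = {p (r e), q (g c)}"
      using c(1) \<phi>_leaf[OF e] \<phi>_centre by (metis image_empty image_insert)
    with g_less[OF c(3)] show ?thesis by blast
  qed
  have "inj_on \<phi> (verts G)"
  proof (rule inj_onI)
    fix v w assume vw: "v \<in> verts G" "w \<in> verts G" "\<phi> v = \<phi> w"
    consider d e where "v = leaf d" "w = leaf e" "d \<in> edges G" "e \<in> edges G"
      | d where "v = leaf d" "d \<in> edges G" "w \<notin> leaf ` edges G"
      | e where "w = leaf e" "e \<in> edges G" "v \<notin> leaf ` edges G"
      | "v \<notin> leaf ` edges G" "w \<notin> leaf ` edges G" by blast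
    then show "v = w"
    proof cases
      case 1
      then have "r d = r e"
        using vw(3) \<phi>_leaf inj_onD[OF pq(1)] r_less by (metis lessThan_iff)
      with 1 show ?thesis using inj_onD[OF inj_r, of d e] by simp
    next
      case 2
      then show ?thesis using vw \<phi>_leaf \<phi>_centre pq(3)[OF r_less g_less] by metis
    next
      case 3
      then show ?thesis using vw \<phi>_leaf \<phi>_centre pq(3)[OF r_less g_less] by metis
    next
      case 4
      then have "g v = g w"
        using vw \<phi>_centre inj_onD[OF pq(2)] g_less by (metis lessThan_iff)
      with vw g(2) show ?thesis by (auto dest: inj_onD)
    qed
  qed
  moreover have "\<phi> ` verts G \<subseteq> verts K"
    using pq(6)[OF r_less] pq(7)[OF g_less] by (auto simp: \<phi>_def)
  moreover have edge: "\<phi> ` e \<in> edges K" if "e \<in> edges G" for e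
    using \<phi>_edge[OF that] pq(4)[OF r_less] by auto
  moreover have "(\<phi> ` d, \<phi> ` e) \<in> L" if de: "(d, e) \<in> M" for d e
  proof (cases "d = e")
    case True
    then show ?thesis
      using edge edge_orderingD(1)[OF M] edge_orderingD(4)[OF K(2)] de by blast
  next
    case False
    have "d \<in> edges G" "e \<in> edges G" using edge_orderingD(1)[OF M] de by auto
    from \<phi>_edge[OF this(1)] \<phi>_edge[OF this(2)]
    obtain j j' where "j < m" "j' < m" "\<phi> ` d = {p (r d), q j}" "\<phi> ` e = {p (r e), q j'}"
      by blast
    then show ?thesis using pq(5)[OF r_mono[OF de False] r_less] by simp
  qed
  ultimately show ?thesis
    using eo_contains_iff_embedding[OF K(1) sG K(2) M] by blast
qed

text \<open>Two consecutive comparisons determine the order of three edges, by reflexivity,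
  transitivity and antisymmetry.\<close>

lemma eo_contains_three_edges:
  assumes K: "simple_graph K" "edge_ordering K L" and H: "simple_graph H" "edge_ordering H M"
    and E: "edges H = {e1, e2, e3}" "e1 \<noteq> e2" "e2 \<noteq> e3" "e1 \<noteq> e3"
    and M: "(e1, e2) \<in> M" "(e2, e3) \<in> M"
    and \<phi>: "inj_on \<phi> (verts H)" "\<phi> ` verts H \<subseteq> verts K"
    and L: "(\<phi> ` e1, \<phi> ` e2) \<in> L" "(\<phi> ` e2, \<phi> ` e3) \<in> L"
  shows "eo_contains K L H M"
proof -
  have edge: "\<phi> ` e \<in> edges K" if "e \<in> edges H" for e
    using L edge_orderingD(1)[OF K(2)] that E(1) by auto
  have refl: "(\<phi> ` e, \<phi> ` e) \<in> L" if "e \<in> edges H" for e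
    using edge[OF that] edge_orderingD(4)[OF K(2)] by blast
  have M13: "(e1, e3) \<in> M" and L13: "(\<phi> ` e1, \<phi> ` e3) \<in> L"
    using M L edge_orderingD(2)[OF H(2)] edge_orderingD(2)[OF K(2)] by (auto dest: transD)
  have anti: "(e2, e1) \<notin> M" "(e3, e2) \<notin> M" "(e3, e1) \<notin> M"
    using M M13 E edge_orderingD(3)[OF H(2)] by (auto dest: antisymD)
  have "(\<phi> ` d, \<phi> ` e) \<in> L" if "(d, e) \<in> M" for d e
  proof -
    have "d \<in> {e1, e2, e3}" "e \<in> {e1, e2, e3}"
      using that edge_orderingD(1)[OF H(2)] E(1) by auto
    then show ?thesis
      using that anti refl E(1) L L13 by auto
  qed
  with \<phi> edge show ?thesis
    using eo_contains_iff_embedding[OF K(1) H(1) K(2) H(2)] by blast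
qed

text \<open>With \<open>{a, b}\<close> before \<open>{c, d}\<close>, only the position of the middle
  edge is open: first, between or last. In each case two adjacent path edges share a major vertex
  and the remaining comparison is between \<open>p 0\<close> and \<open>p 1\<close>.\<close>

lemma eo_contains_path:
  assumes sG: "simple_graph G" and M: "edge_ordering G M"
    and dist: "distinct [a, b, c, d]" and V: "verts G = {a, b, c, d}"
    and E: "edges G = {{a, b}, {b, c}, {c, d}}" and less: "({a, b}, {c, d}) \<in> M"
    and K: "simple_graph K" "edge_ordering K L" and pq: "major_ordered K L 2 p q"
  shows "eo_contains K L G M"
proof -
  note pq = major_orderedD[OF K(1) pq]
  have neq: "p 0 \<noteq> p 1" "q 0 \<noteq> q 1"
    using inj_onD[OF pq(1), of 0 1] inj_onD[OF pq(2), of 0 1] by auto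
  \<comment> \<open>The default value \<open>w\<close> is the image of \<open>a\<close>.\<close>
  have map: "\<exists>\<phi>. inj_on \<phi> (verts G) \<and> \<phi> ` verts G \<subseteq> verts K \<and>
      \<phi> ` {a, b} = {w, x} \<and> \<phi> ` {b, c} = {x, y} \<and> \<phi> ` {c, d} = {y, z}"
    if "distinct [w, x, y, z]" "{w, x, y, z} \<subseteq> verts K" for w x y z
    using dist that
    by (intro exI[of _ "(\<lambda>v. w)(b := x, c := y, d := z)"]) (auto simp: V)
  \<comment> \<open>At a fixed major vertex the two edges come in an unknown order; naming their
    minor ends accordingly yields whichever order is wanted.\<close>
  have q: "\<exists>i j. i < 2 \<and> j < 2 \<and> i \<noteq> j \<and> ({p k, q i}, {p k, q j}) \<in> L" if "k < 2" for k
  proof -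
    have "({p k, q 0}, {p k, q 1}) \<in> L \<or> ({p k, q 1}, {p k, q 0}) \<in> L"
      using that pq(4) by (intro edge_orderingD(4)[OF K(2)]) auto
    then show ?thesis by (metis one_less_numeral_iff pos2 semiring_norm(76) zero_neq_one)
  qed
  obtain i j where ij: "i < 2" "j < 2" "i \<noteq> j" "({p 1, q i}, {p 1, q j}) \<in> L"
    using q[of 1] by auto
  obtain i' j' where ij': "i' < 2" "j' < 2" "i' \<noteq> j'" "({p 0, q i'}, {p 0, q j'}) \<in> L"
    using q[of 0] by auto
  have qneq: "q i \<noteq> q j" "q i' \<noteq> q j'"
    using pq(2) ij ij' by (auto simp: inj_on_def)
  have Eneq: "{a, b} \<noteq> {b, c}" "{b, c} \<noteq> {c, d}" "{a, b} \<noteq> {c, d}"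
    using dist by (auto simp: doubleton_eq_iff)
  have "({b, c}, {a, b}) \<in> M \<or> ({a, b}, {b, c}) \<in> M" "({b, c}, {c, d}) \<in> M \<or> ({c, d}, {b, c}) \<in> M"
    using edge_orderingD(4)[OF M] E by auto
  then consider "({b, c}, {a, b}) \<in> M" | "({a, b}, {b, c}) \<in> M" "({b, c}, {c, d}) \<in> M"
    | "({c, d}, {b, c}) \<in> M" by blast
  then show ?thesis
  proof cases
    case 1
    have "distinct [q j', p 0, q i', p 1]" "{q j', p 0, q i', p 1} \<subseteq> verts K"
      using pq(3,6,7) neq qneq ij' by (auto simp: eq_commute[of "q _" "p _"])
    from map[OF this] obtain \<phi> where \<phi>: "inj_on \<phi> (verts G)" "\<phi> ` verts G \<subseteq> verts K"
      "\<phi> ` {a, b} = {q j', p 0}" "\<phi> ` {b, c} = {p 0, q i'}" "\<phi> ` {c, d} = {q i', p 1}" by blast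
    have "(\<phi> ` {b, c}, \<phi> ` {a, b}) \<in> L" "(\<phi> ` {a, b}, \<phi> ` {c, d}) \<in> L"
      unfolding \<phi>(3-5) insert_commute[of "q _"] using ij' pq(5) by auto
    with \<phi>(1,2) 1 less E Eneq show ?thesis
      by (intro eo_contains_three_edges[OF K sG M, of "{b, c}" "{a, b}" "{c, d}"]) auto
  next
    case 2
    have "distinct [p 0, q i, p 1, q j]" "{p 0, q i, p 1, q j} \<subseteq> verts K"
      using pq(3,6,7) neq qneq ij by (auto simp: eq_commute[of "q _" "p _"])
    from map[OF this] obtain \<phi> where \<phi>: "inj_on \<phi> (verts G)" "\<phi> ` verts G \<subseteq> verts K"
      "\<phi> ` {a, b} = {p 0, q i}" "\<phi> ` {b, c} = {q i, p 1}" "\<phi> ` {c, d} = {p 1, q j}" by blast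
    have "(\<phi> ` {a, b}, \<phi> ` {b, c}) \<in> L" "(\<phi> ` {b, c}, \<phi> ` {c, d}) \<in> L"
      unfolding \<phi>(3-5) insert_commute[of "q _"] using ij pq(5) by auto
    with \<phi>(1,2) 2 E Eneq show ?thesis
      by (intro eo_contains_three_edges[OF K sG M, of "{a, b}" "{b, c}" "{c, d}"]) auto
  next
    case 3
    have "distinct [p 0, q j, p 1, q i]" "{p 0, q j, p 1, q i} \<subseteq> verts K"
      using pq(3,6,7) neq qneq ij by (auto simp: eq_commute[of "q _" "p _"])
    from map[OF this] obtain \<phi> where \<phi>: "inj_on \<phi> (verts G)" "\<phi> ` verts G \<subseteq> verts K"
      "\<phi> ` {a, b} = {p 0, q j}" "\<phi> ` {b, c} = {q j, p 1}" "\<phi> ` {c, d} = {p 1, q i}" by blast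
    have "(\<phi> ` {a, b}, \<phi> ` {c, d}) \<in> L" "(\<phi> ` {c, d}, \<phi> ` {b, c}) \<in> L"
      unfolding \<phi>(3-5) insert_commute[of "q _"] using ij pq(5) by auto
    with \<phi>(1,2) 3 less E Eneq show ?thesis
      by (intro eo_contains_three_edges[OF K sG M, of "{a, b}" "{c, d}" "{b, c}"]) auto
  qed
qed

lemma chi_plus_path:
  assumes "finite_simple_graph G" "graph_isomorphic G (path_graph 4)"
  shows "chi_plus G = 2"
proof (rule chi_plus_eqI[OF assms(1)])
  fix M assume M: "edge_ordering G M"
  have sG: "simple_graph G" using assms(1) by (simp add: finite_simple_graph_def)
  obtain a b c d where abcd: "distinct [a, b, c, d]" "verts G = {a, b, c, d}"
    "edges G = {{a, b}, {b, c}, {c, d}}"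
    using assms(2) graph_isomorphic_path_graph_4_iff[OF sG] by blast
  then have dcba: "distinct [d, c, b, a]" "verts G = {d, c, b, a}"
    "edges G = {{d, c}, {c, b}, {b, a}}"
    by (auto simp: insert_commute)
  \<comment> \<open>Reading the path backwards exchanges its end edges, so one of the two readings
    meets the assumption of \<open>eo_contains_path\<close>.\<close>
  have "({a, b}, {c, d}) \<in> M \<or> ({d, c}, {b, a}) \<in> M"
    using edge_orderingD(4)[OF M, of "{a, b}" "{c, d}"] abcd(3) by (auto simp: insert_commute)
  then have "eo_contains K L G M"
    if "simple_graph K" "edge_ordering K L" "major_ordered K L 2 p q" for K :: "nat sgraph" and L p q
    using eo_contains_path[OF sG M abcd _ that] eo_contains_path[OF sG M dcba _ that] by blast
  moreover have "edges G \<noteq> {}" using abcd by simp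
  ultimately show "order_chromatic_number G M = 2"
    using sG M by (intro order_chromatic_number_eq_2)
qed

lemma chi_plus_star_forest:
  assumes "finite_simple_graph G" "star_forest G"
  shows "chi_plus G = 2"
proof (rule chi_plus_eqI[OF assms(1)])
  fix M assume M: "edge_ordering G M"
  have "simple_graph G" "edges G \<noteq> {}"
    using assms by (auto simp: finite_simple_graph_def star_forest_def)
  then show "order_chromatic_number G M = 2"
    using M eo_contains_if_star_forest[OF assms M] by (rule order_chromatic_number_eq_2)
qed

text \<open>Every permutation of the edges of a triangle comes from one of its vertices:
  \<open>x\<close> is the common vertex of the first two edges, \<open>z\<close> that of the last
  two. Hence all orderings are isomorphic.\<close>

lemma ordered_triangle:
  assumes M: "edge_ordering G M" and "distinct [a, b, c]" "verts G = {a, b, c}"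
    "edges G = {{a, b}, {a, c}, {b, c}}"
  obtains x y z where "distinct [x, y, z]" "verts G = {x, y, z}" "edges G = {{x, y}, {x, z}, {y, z}}"
    "({x, y}, {x, z}) \<in> M" "({x, z}, {y, z}) \<in> M"
proof -
  have total: "({a, b}, {a, c}) \<in> M \<or> ({a, c}, {a, b}) \<in> M" "({a, b}, {b, c}) \<in> M \<or> ({b, c}, {a, b}) \<in> M"
    "({a, c}, {b, c}) \<in> M \<or> ({b, c}, {a, c}) \<in> M"
    using edge_orderingD(4)[OF M] assms(4) by auto
  have comm: "{b, a} = {a, b}" "{c, a} = {a, c}" "{c, b} = {b, c}" by auto
  consider "({a, b}, {a, c}) \<in> M" "({a, c}, {b, c}) \<in> M"
    | "({a, b}, {b, c}) \<in> M" "({b, c}, {a, c}) \<in> M"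
    | "({a, c}, {a, b}) \<in> M" "({a, b}, {b, c}) \<in> M"
    | "({a, c}, {b, c}) \<in> M" "({b, c}, {a, b}) \<in> M"
    | "({b, c}, {a, b}) \<in> M" "({a, b}, {a, c}) \<in> M"
    | "({b, c}, {a, c}) \<in> M" "({a, c}, {a, b}) \<in> M"
    using total by blast
  then show thesis
  proof cases
    case 1
    with assms show thesis by (intro that[of a b c])
  next
    case 2
    with assms show thesis by (intro that[of b a c]) (auto simp: comm)
  next
    case 3
    with assms show thesis by (intro that[of a c b]) (auto simp: comm)
  next
    case 4
    with assms show thesis by (intro that[of c a b]) (auto simp: comm)
  next
    case 5
    with assms show thesis by (intro that[of b c a]) (auto simp: comm)
  next
    case 6
    with assms show thesis by (intro that[of c b a]) (auto simp: comm)
  qed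
qed

lemma finite_simple_complete_graph_3: "finite_simple_graph (complete_graph 3)"
  using simple_complete_graph_3 by (simp add: finite_simple_graph_def complete_graph_3)

lemma chi_plus_triangle:
  assumes "finite_simple_graph G" "graph_isomorphic G (complete_graph 3)"
  shows "chi_plus G = 3"
proof (rule chi_plus_eqI[OF assms(1)])
  fix M assume M: "edge_ordering G M"
  have sG: "simple_graph G" using assms(1) by (simp add: finite_simple_graph_def)
  obtain a b c where "distinct [a, b, c]" "verts G = {a, b, c}" "edges G = {{a, b}, {a, c}, {b, c}}"
    using assms(2) graph_isomorphic_complete_graph_3_iff[OF sG] by blast
  then obtain x y z where xyz: "distinct [x, y, z]" "verts G = {x, y, z}"
    "edges G = {{x, y}, {x, z}, {y, z}}" "({x, y}, {x, z}) \<in> M" "({x, z}, {y, z}) \<in> M"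
    by (rule ordered_triangle[OF M])
  let ?K = "complete_graph 3"
  have "order_chromatic_number G M = enat 3"
  proof (rule order_chromatic_number_eqI[OF finite_simple_complete_graph_3])
    have "eo_contains ?K L G M" if L: "edge_ordering ?K L" for L
    proof -
      obtain u v w where uvw: "distinct [u, v, w]" "verts ?K = {u, v, w}"
        "({u, v}, {u, w}) \<in> L" "({u, w}, {v, w}) \<in> L"
        by (rule ordered_triangle[OF L _ complete_graph_3]) auto
      have Eneq: "{x, y} \<noteq> {x, z}" "{x, z} \<noteq> {y, z}" "{x, y} \<noteq> {y, z}"
        using xyz(1) by (auto simp: doubleton_eq_iff)
      \<comment> \<open>Both triangles are labelled by their own order, so matching
        \<open>x, y, z\<close> with \<open>u, v, w\<close> preserves it.\<close>
      show ?thesis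
        using xyz(1,2) uvw
        by (intro eo_contains_three_edges[OF simple_complete_graph_3 L sG M xyz(3) Eneq xyz(4,5),
              of "(\<lambda>_. u)(y := v, z := w)"]) auto
    qed
    then show "\<not> can_avoid ?K G M" by (auto simp: can_avoid_def)
    have "proper_colouring ?K 3 id"
      by (auto simp: proper_colouring_def complete_graph_3 doubleton_eq_iff)
    then show "chromatic_number ?K \<le> 3" by (rule chromatic_number_le)
  next
    fix K :: "nat sgraph" assume K: "finite_simple_graph K" "\<not> can_avoid K G M"
    obtain \<phi> where "\<And>e. e \<in> edges G \<Longrightarrow> \<phi> ` e \<in> edges K"
      using embedding_if_not_can_avoid[OF K(1) sG M K(2)] by blast
    from this[of "{x, y}"] this[of "{x, z}"] this[of "{y, z}"] show "3 \<le> chromatic_number K"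
      using xyz(3) three_le_chromatic_number[OF K(1)] by simp
  qed
  then show "order_chromatic_number G M = 3" by (simp add: numeral_eq_enat)
qed

theorem theorem2p18:
  fixes G :: "'a sgraph"
  assumes "finite_simple_graph G"
    and "edges G \<noteq> {}"
    and "\<not> (\<exists>v. isolated_vertex G v)"
  shows "(star_forest G \<or> graph_isomorphic G (path_graph 4) \<longrightarrow> chi_plus G = 2) \<and>
         (graph_isomorphic G (complete_graph 3) \<longrightarrow> chi_plus G = 3) \<and>
         (\<not> star_forest G \<and> \<not> graph_isomorphic G (path_graph 4) \<and>
            \<not> graph_isomorphic G (complete_graph 3) \<longrightarrow> chi_plus G = \<infinity>)"
  using chi_plus_star_forest[OF assms(1)] chi_plus_path[OF assms(1)] chi_plus_triangle[OF assms(1)]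
    chi_plus_eq_infinity_if_not_exceptional[OF assms] by blast

end
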